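(* Let $p,q>0$ with $p+q=1$ and $a\ge2$. The Doob $h$-transform with $h(z)=(q/p)^z$ maps the biased random walk on $\{0,\dots,a\}$ with up-probability $p$, down-probability $q$ and invariant $K=(p/q)^a$ to the oppositely biased walk (up-probability $q$, down-probability $p$), whose invariant is $K^h=(q/p)^a=1/K$, inducing the exact duality $$C^*\longmapsto 1-C^*,\qquad\text{i.e.}\quad \frac{1}{1+\sqrt{K^h}}=1-\frac{1}{1+\sqrt K}.$$ The symmetric value $C^*=1/2$ (equivalently $K=1$, equivalently $p=q$) is the unique fixed point of this duality. In particular, the $h$-transform exchanges the two regimes $C^*<1/2$ and $C^*>1/2$.
   Context: The biased random walk on $\{0,\dots,a\}$ steps from each interior site $z\in\{1,\dots,a-1\}$ to $z+1$ with probability $p$ and to $z-1$ with probability $q$, and is absorbed at $0$ and $a$. Its canonical weight is $\kappa(z)=(p/q)^{a-z}$ with involution $\sigma(z)=a-z$, its invariant is $K=\kappa(z)\kappa(\sigma(z))=(p/q)^a$, and its critical value is $C^*=1/(1+\sqrt K)$; for the walk with $p$ and $q$ exchanged, the canonical weight is $\kappa^h(z)=(q/p)^{a-z}$, with invariant $K^h$ and critical value $1/(1+\sqrt{K^h})$. The Doob $h$-transform of transition probabilities $P_{z,w}$ is $P^h_{z,w}=\dfrac{h(w)}{h(z)}P_{z,w}$. *)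

theory Defs
  imports Complex_Main
begin

(* Only the values for z, w in {0..a} are meaningful; every state outside the
   interior, in particular 0 and a, is absorbing. *)
definition walk_trans :: "real \<Rightarrow> real \<Rightarrow> nat \<Rightarrow> nat \<Rightarrow> nat \<Rightarrow> real" where
  "walk_trans p q a z w =
     (if 1 \<le> z \<and> z \<le> a - 1
      then (if w = z + 1 then p else if w = z - 1 then q else 0)
      else (if w = z then 1 else 0))"

definition doob_transform :: "('s \<Rightarrow> real) \<Rightarrow> ('s \<Rightarrow> 's \<Rightarrow> real) \<Rightarrow> 's \<Rightarrow> 's \<Rightarrow> real" where
  "doob_transform h P z w = h w / h z * P z w"

definition canonical_weight :: "real \<Rightarrow> real \<Rightarrow> nat \<Rightarrow> nat \<Rightarrow> real" where
  "canonical_weight p q a z = (p / q) ^ (a - z)"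

definition reflection :: "nat \<Rightarrow> nat \<Rightarrow> nat" where
  "reflection a z = a - z"

(* The common value of kappa(z) * kappa(sigma(z)) over all sites z; that there is
   such a common value for the biased walk has to be proved. *)
definition walk_invariant :: "real \<Rightarrow> real \<Rightarrow> nat \<Rightarrow> real" where
  "walk_invariant p q a =
     (THE K. \<forall>z\<in>{0..a}. canonical_weight p q a z * canonical_weight p q a (reflection a z) = K)"

definition critical_value :: "real \<Rightarrow> real" where
  "critical_value K = 1 / (1 + sqrt K)"

end

theory Submission
  imports Defs
begin

text \<open>The function $h(z) = (q/p)^z$ is harmonic for the biased walk, and its ratio
  $h(z \pm 1)/h(z) = (q/p)^{\pm 1}$ turns a step up, of weight $p$, into one of weight $q$ and a step
  down, of weight $q$, into one of weight $p$. Exchanging $p$ and $q$ inverts the base of the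
  invariant $K = (p/q)^a$, so it replaces $\sqrt K$ by its inverse; and
  $1/(1+s^{-1}) = s/(1+s) = 1 - 1/(1+s)$ is the duality (lemma \<open>critical_value_inverse\<close>). Everything
  said about fixed points and regimes follows from this reflection about $1/2$ and
  the fact that $K = 1$ is the point where the critical value equals $1/2$.\<close>

lemma doob_transform_walk_trans:
  assumes "p \<noteq> 0" and "q \<noteq> 0"
  shows "doob_transform (\<lambda>z. (q / p) ^ z) (walk_trans p q a) z w = walk_trans q p a z w"
proof (cases "1 \<le> z \<and> z \<le> a - 1")
  case True
  \<comment> \<open>A predecessor of the site makes the ratio of the step down a quotient of powers
    without truncated subtraction.\<close>
  then obtain y where "z = Suc y"
    by (cases z) auto
  with True assms show ?thesis
    by (auto simp: doob_transform_def walk_trans_def field_simps)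
next
  case False
  with assms show ?thesis
    by (auto simp: doob_transform_def walk_trans_def)
qed

text \<open>The exponents $a - z$ and $a - (a - z) = z$ add up to $a$; the bound on the site keeps the
  truncated subtraction harmless.\<close>

lemma canonical_weight_reflection:
  assumes "z \<le> a"
  shows "canonical_weight p q a z * canonical_weight p q a (reflection a z) = (p / q) ^ a"
  using assms by (simp add: canonical_weight_def reflection_def flip: power_add)

lemma walk_invariant_eq: "walk_invariant p q a = (p / q) ^ a"
  unfolding walk_invariant_def
proof (rule the_equality)
  fix K
  assume "\<forall>z\<in>{0..a}. canonical_weight p q a z * canonical_weight p q a (reflection a z) = K"
  then show "K = (p / q) ^ a"
    using canonical_weight_reflection[of 0 a p q] by auto
qed (simp add: canonical_weight_reflection)

lemma critical_value_inverse:
  assumes "K > 0"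
  shows "critical_value (1 / K) = 1 - critical_value K"
proof -
  have "sqrt K > 0" using assms by simp
  then have "sqrt K \<noteq> 0" and "1 + sqrt K \<noteq> 0" by linarith+
  then show ?thesis
    by (simp add: critical_value_def real_sqrt_divide field_simps)
qed

lemma critical_value_eq_half_iff:
  assumes "K > 0"
  shows "critical_value K = 1 / 2 \<longleftrightarrow> K = 1"
proof -
  have "sqrt K > 0" using assms by simp
  then have "critical_value K = 1 / 2 \<longleftrightarrow> sqrt K = 1"
    by (auto simp: critical_value_def divide_simps)
  then show ?thesis by simp
qed

theorem mainTheorem10:
  fixes p q :: real and a :: nat
  assumes "p > 0" and "q > 0" and "p + q = 1" and "a \<ge> 2"
  shows
    "(let h = (\<lambda>z::nat. (q / p) ^ z);
          K = walk_invariant p q a;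
          Kh = walk_invariant q p a;
          C = critical_value K;
          Ch = critical_value Kh
      in
        (\<forall>z\<in>{0..a}. \<forall>w\<in>{0..a}.
            doob_transform h (walk_trans p q a) z w = walk_trans q p a z w) \<and>
        (\<forall>z\<in>{0..a}.
            canonical_weight p q a z * canonical_weight p q a (reflection a z) = K \<and>
            canonical_weight q p a z * canonical_weight q p a (reflection a z) = Kh) \<and>
        K = (p / q) ^ a \<and>
        Kh = (q / p) ^ a \<and>
        Kh = 1 / K \<and>
        Ch = 1 - C \<and>
        (\<forall>x::real. 1 - x = x \<longleftrightarrow> x = 1 / 2) \<and>
        (Ch = C \<longleftrightarrow> C = 1 / 2) \<and>
        (C = 1 / 2 \<longleftrightarrow> K = 1) \<and>
        (K = 1 \<longleftrightarrow> p = q) \<and>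
        (C < 1 / 2 \<longleftrightarrow> Ch > 1 / 2) \<and>
        (C > 1 / 2 \<longleftrightarrow> Ch < 1 / 2))"
proof -
  define K where "K = walk_invariant p q a"
  define Kh where "Kh = walk_invariant q p a"
  have K: "K = (p / q) ^ a" and Kh: "Kh = (q / p) ^ a"
    by (simp_all add: K_def Kh_def walk_invariant_eq)
  have pos: "K > 0"
    using assms by (simp add: K)
  have inverse: "Kh = 1 / K"
    by (simp add: K Kh power_divide)
  have dual: "critical_value Kh = 1 - critical_value K"
    using critical_value_inverse[OF pos] by (simp add: inverse)
  have symmetric: "K = 1 \<longleftrightarrow> p = q"
    using assms power_eq_iff_eq_base[of a "p / q" 1] by (auto simp: K)
  have weights: "\<forall>z\<in>{0..a}.
      canonical_weight p q a z * canonical_weight p q a (reflection a z) = K \<and>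
      canonical_weight q p a z * canonical_weight q p a (reflection a z) = Kh"
    by (simp add: K Kh canonical_weight_reflection)
  have transform: "\<forall>z\<in>{0..a}. \<forall>w\<in>{0..a}.
      doob_transform (\<lambda>z. (q / p) ^ z) (walk_trans p q a) z w = walk_trans q p a z w"
    using assms by (simp add: doob_transform_walk_trans)
  show ?thesis
    unfolding Let_def K_def[symmetric] Kh_def[symmetric]
    using transform weights K Kh inverse dual critical_value_eq_half_iff[OF pos] symmetric
    by (intro conjI) (assumption | linarith | force)+
qed

end
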